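(* Let $n\ge 1$, let $w\in \mathrm{F}(A)$ and let $\mathbf p=(p_1,\dots,p_n)=\mathbf{F}_w\star$ be the system state obtained by applying the evolution $\mathbf{F}_w$ of the update system $\mathcal{S}_n^\star$ to the system state $\star=(\star,\dots,\star)$. Then: (i) $\operatorname{Can} w=[p_n,[\dots,[p_2,p_1]\dots]]$; (ii) if $u,v\in \mathrm{F}(A)$, then $\mathbf{F}_u=\mathbf{F}_v$ if and only if $\operatorname{Can}u=\operatorname{Can}v$; (iii) Kiselman's semigroup $\mathrm{K}_n$ is isomorphic to the dynamics monoid $D(\mathcal{S}_n^\star)$.
   Context: Words. $A=\{a_1,\dots,a_n\}$; $\mathrm{F}(A)$ is the free monoid over $A$ and $\star$ is the empty word. A subword of $w$ is a substring of consecutive letters of $w$; a quasi-subword of $w$ is an ordered substring of not necessarily consecutive letters of $w$. Kiselman's semigroup. $\mathrm{K}_n$ is the monoid with presentation $\langle a_1,\dots,a_n \mid a_i^2=a_i \text{ for all } i;\ a_ia_ja_i=a_ja_ia_j=a_ia_j \text{ for } i<j\rangle$, and $\pi:\mathrm{F}(A)\to\mathrm{K}_n$ is the canonical epimorphism. A subword of the form $a_iua_i$ ($u\in \mathrm{F}(A)$) is special if $u$ contains both some $a_j$ with $j>i$ and some $a_k$ with $k<i$. A word is canonical if all its subwords of the form $a_iua_i$ are special. It is known (Kudryavtseva–Mazorchuk) that every fibre of $\pi$ contains exactly one canonical word; $\operatorname{Can} w$ denotes the unique canonical word in $\pi^{-1}\pi(w)$. Join. For $u,v\in \mathrm{F}(A)$,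 the join is $[u,v]=u^+v$, where $u=u^+u^-$ and $u^-$ is the longest suffix of $u$ which is a quasi-subword of $v$. The nested expression $[p_n,[\dots,[p_2,p_1]\dots]]$ means $p_1$ if $n=1$. For subsets $U,V\subset\mathrm{F}(A)$, $[U,V]=\{[u,v]: u\in U, v\in V\}$. The update system $\mathcal{S}_n^\star$. The base graph is $\Gamma_n$, with vertices $1,\dots,n$ and an arrow $i\to j$ if and only if $i<j$. The finite state sets $S_i\subset\mathrm{F}(A)$ are $S_n=\{\star,a_n\}$, $S_{n-1}=\{\star,a_{n-1},a_{n-1}a_n\}$, and $S_i=\{\star\}\cup a_i[S_n,[\dots,[S_{i+2},S_{i+1}]\dots]]$ for $1\le i\le n-2$. The vertex functions $f_i:\prod_{j>i}S_j\to S_i$ are $f_n\equiv a_n$ (constant), $f_{n-1}(s_n)=a_{n-1}s_n$, and $f_i(s_{i+1},\dots,s_n)=a_i[s_n,[\dots,[s_{i+2},s_{i+1}]\dots]]$ for $i\le n-2$. Let $S=\prod_i S_i$ be the set of system states; the state $(\star,\dots,\star)$ is also denoted $\star$. The $\Gamma$-local function $\mathbf{F}_i:S\to S$ replaces the $i$-th component of $\mathbf s=(s_1,\dots,s_n)$ by $f_i(s_{i+1},\dots,s_n)$ and leaves all other components unchanged. For $w=a_{i_1}a_{i_2}\cdots a_{i_k}\in\mathrm{F}(A)$ (identifying the letter $a_i$ with the vertex $i$), $\mathbf{F}_w=\mathbf{F}_{i_1}\mathbf{F}_{i_2}\cdots\mathbf{F}_{i_k}$ (composition of maps, rightmost applied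 first), and $\mathbf{F}_\star$ is the identity. The dynamics monoid $D(\mathcal{S}_n^\star)$ is the monoid $\{\mathbf{F}_w: w\in\mathrm{F}(A)\}$ under composition. *)

theory Defs
  imports "HOL-Algebra.Group" "HOL-Library.Sublist"
begin

section \<open>Monoids given by a presentation\<close>

text \<open>Words are lists; the free monoid over a set \<open>A\<close> is \<^term>\<open>lists A\<close> with
  concatenation and the empty word \<^term>\<open>[]\<close>.\<close>

inductive_set pres_cong :: "'a set \<Rightarrow> ('a list \<times> 'a list) set \<Rightarrow> ('a list \<times> 'a list) set"
  for A R
where
  rel: "(u, v) \<in> R \<Longrightarrow> u \<in> lists A \<Longrightarrow> v \<in> lists A \<Longrightarrow> (u, v) \<in> pres_cong A R"
| refl: "u \<in> lists A \<Longrightarrow> (u, u) \<in> pres_cong A R"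
| sym: "(u, v) \<in> pres_cong A R \<Longrightarrow> (v, u) \<in> pres_cong A R"
| trans: "(u, v) \<in> pres_cong A R \<Longrightarrow> (v, w) \<in> pres_cong A R \<Longrightarrow> (u, w) \<in> pres_cong A R"
| ctxt: "(u, v) \<in> pres_cong A R \<Longrightarrow> x \<in> lists A \<Longrightarrow> y \<in> lists A
    \<Longrightarrow> (x @ u @ y, x @ v @ y) \<in> pres_cong A R"

definition presented_monoid :: "'a set \<Rightarrow> ('a list \<times> 'a list) set \<Rightarrow> 'a list set monoid" where
  "presented_monoid A R =
     \<lparr>carrier = lists A // pres_cong A R,
      mult = (\<lambda>X Y. \<Union>x\<in>X. \<Union>y\<in>Y. pres_cong A R `` {x @ y}),
      one = pres_cong A R `` {[]}\<rparr>"

lemma pres_cong_in_lists: "(u, v) \<in> pres_cong A R \<Longrightarrow> u \<in> lists A \<and> v \<in> lists A"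
  by (induction rule: pres_cong.induct) auto

lemma equiv_pres_cong: "equiv (lists A) (pres_cong A R)"
proof (rule equivI)
  show "pres_cong A R \<subseteq> lists A \<times> lists A"
    by (auto dest: pres_cong_in_lists)
  show "refl_on (lists A) (pres_cong A R)"
    by (intro refl_onI) (blast intro: pres_cong.refl)
  show "Relation.sym (pres_cong A R)"
    by (rule symI) (rule pres_cong.sym)
  show "Relation.trans (pres_cong A R)"
    by (rule transI) (rule pres_cong.trans)
qed

lemma pres_cong_append:
  assumes "(u, u') \<in> pres_cong A R" "(v, v') \<in> pres_cong A R"
  shows "(u @ v, u' @ v') \<in> pres_cong A R"
proof -
  have "([] @ u @ v, [] @ u' @ v) \<in> pres_cong A R"
    by (rule pres_cong.ctxt) (use assms pres_cong_in_lists in blast)+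
  moreover have "(u' @ v @ [], u' @ v' @ []) \<in> pres_cong A R"
    by (rule pres_cong.ctxt) (use assms pres_cong_in_lists in blast)+
  ultimately show ?thesis unfolding append_Nil append_Nil2 by (rule pres_cong.trans)
qed

lemma presented_monoid_mult_class:
  assumes "u \<in> lists A" "v \<in> lists A"
  shows "pres_cong A R `` {u} \<otimes>\<^bsub>presented_monoid A R\<^esub> pres_cong A R `` {v} = pres_cong A R `` {u @ v}"
proof -
  have *: "pres_cong A R `` {x @ y} = pres_cong A R `` {u @ v}"
    if "x \<in> pres_cong A R `` {u}" "y \<in> pres_cong A R `` {v}" for x y
  proof (rule equiv_class_eq[OF equiv_pres_cong])
    from that have "(u @ v, x @ y) \<in> pres_cong A R"
      by (intro pres_cong_append) simp_all
    then show "(x @ y, u @ v) \<in> pres_cong A R" by (rule pres_cong.sym)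
  qed
  have "u \<in> pres_cong A R `` {u}" "v \<in> pres_cong A R `` {v}"
    using assms by (simp_all add: pres_cong.refl)
  then have ne: "pres_cong A R `` {u} \<noteq> {}" "pres_cong A R `` {v} \<noteq> {}" by blast+
  have "pres_cong A R `` {u} \<otimes>\<^bsub>presented_monoid A R\<^esub> pres_cong A R `` {v} =
      (\<Union>x\<in>pres_cong A R `` {u}. \<Union>y\<in>pres_cong A R `` {v}. pres_cong A R `` {u @ v})"
    unfolding presented_monoid_def monoid.simps by (intro SUP_cong HOL.refl *)
  also have "\<dots> = pres_cong A R `` {u @ v}"
    using ne by (simp only: UN_constant if_False)
  finally show ?thesis .
qed

lemma monoid_presented_monoid: "monoid (presented_monoid A R)"
proof -
  have c: "carrier (presented_monoid A R) = (\<lambda>u. pres_cong A R `` {u}) ` lists A"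
    by (auto simp: presented_monoid_def quotient_def)
  have o: "\<one>\<^bsub>presented_monoid A R\<^esub> = pres_cong A R `` {[]}"
    by (simp add: presented_monoid_def)
  show ?thesis
  proof (rule monoidI)
    show "x \<otimes>\<^bsub>presented_monoid A R\<^esub> y \<in> carrier (presented_monoid A R)"
      if xy: "x \<in> carrier (presented_monoid A R)" "y \<in> carrier (presented_monoid A R)" for x y
    proof -
      obtain u v where "u \<in> lists A" "v \<in> lists A"
        "x = pres_cong A R `` {u}" "y = pres_cong A R `` {v}"
        using xy unfolding c by blast
      then show ?thesis
        unfolding c by (simp only: presented_monoid_mult_class) (rule imageI, simp)
    qed
    show "\<one>\<^bsub>presented_monoid A R\<^esub> \<in> carrier (presented_monoid A R)"
      unfolding c o by blast
  next
    fix x y z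
    assume "x \<in> carrier (presented_monoid A R)" "y \<in> carrier (presented_monoid A R)"
      "z \<in> carrier (presented_monoid A R)"
    then obtain u v w where *: "u \<in> lists A" "v \<in> lists A" "w \<in> lists A"
      "x = pres_cong A R `` {u}" "y = pres_cong A R `` {v}" "z = pres_cong A R `` {w}"
      unfolding c by blast
    then have "u @ v \<in> lists A" "v @ w \<in> lists A" by auto
    with * show "x \<otimes>\<^bsub>presented_monoid A R\<^esub> y \<otimes>\<^bsub>presented_monoid A R\<^esub> z =
       x \<otimes>\<^bsub>presented_monoid A R\<^esub> (y \<otimes>\<^bsub>presented_monoid A R\<^esub> z)"
      by (simp only: presented_monoid_mult_class append_assoc)
  next
    fix x
    assume "x \<in> carrier (presented_monoid A R)"
    then obtain u where *: "u \<in> lists A" "x = pres_cong A R `` {u}"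
      unfolding c by blast
    have "[] \<in> lists A" by simp
    with * show "\<one>\<^bsub>presented_monoid A R\<^esub> \<otimes>\<^bsub>presented_monoid A R\<^esub> x = x"
      "x \<otimes>\<^bsub>presented_monoid A R\<^esub> \<one>\<^bsub>presented_monoid A R\<^esub> = x"
      unfolding o by (simp_all only: presented_monoid_mult_class append_Nil append_Nil2)
  qed
qed


section \<open>Kiselman's semigroup and canonical words\<close>

text \<open>The letter \<open>a\<^sub>i\<close> is represented by its index \<open>i \<in> {1..n}\<close>, which is also
  the corresponding vertex of the base graph below.\<close>

type_synonym word = "nat list"

definition words :: "nat \<Rightarrow> word set" where
  "words n = lists {1..n}"

definition kiselman_rels :: "nat \<Rightarrow> (word \<times> word) set" where
  "kiselman_rels n =
     {([i, i], [i]) | i. i \<in> {1..n}} \<union>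
     {([i, j, i], [i, j]) | i j. i \<in> {1..n} \<and> j \<in> {1..n} \<and> i < j} \<union>
     {([j, i, j], [i, j]) | i j. i \<in> {1..n} \<and> j \<in> {1..n} \<and> i < j}"

definition kiselman :: "nat \<Rightarrow> word set monoid" where
  "kiselman n = presented_monoid {1..n} (kiselman_rels n)"

definition kiselman_proj :: "nat \<Rightarrow> word \<Rightarrow> word set" where
  "kiselman_proj n w = pres_cong {1..n} (kiselman_rels n) `` {w}"

text \<open>The subword \<open>a\<^sub>i u a\<^sub>i\<close> is special.\<close>

definition special :: "nat \<Rightarrow> word \<Rightarrow> bool" where
  "special i u \<longleftrightarrow> (\<exists>j\<in>set u. j > i) \<and> (\<exists>k\<in>set u. k < i)"

definition canonical :: "word \<Rightarrow> bool" where
  "canonical w \<longleftrightarrow> (\<forall>i u. sublist ([i] @ u @ [i]) w \<longrightarrow> special i u)"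

text \<open>The description is proper: by a theorem of Kudryavtseva and Mazorchuk every fibre of
  the projection contains exactly one canonical word.\<close>

definition Can :: "nat \<Rightarrow> word \<Rightarrow> word" where
  "Can n w = (THE c. c \<in> words n \<and> kiselman_proj n c = kiselman_proj n w \<and> canonical c)"


section \<open>The join\<close>

text \<open>Quasi-subwords are given by \<^const>\<open>subseq\<close>. The functions \<open>join_minus\<close> and
  \<open>join_plus\<close> give the factors \<open>u\<^sup>-\<close> and \<open>u\<^sup>+\<close>, which depend on \<open>v\<close> as well.\<close>

definition join_minus :: "'a list \<Rightarrow> 'a list \<Rightarrow> 'a list" where
  "join_minus u v = (ARG_MAX length s. suffix s u \<and> subseq s v)"

definition join_plus :: "'a list \<Rightarrow> 'a list \<Rightarrow> 'a list" where
  "join_plus u v = take (length u - length (join_minus u v)) u"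

definition word_join :: "'a list \<Rightarrow> 'a list \<Rightarrow> 'a list" where
  "word_join u v = join_plus u v @ v"

definition set_join :: "'a list set \<Rightarrow> 'a list set \<Rightarrow> 'a list set" where
  "set_join U V = {word_join u v | u v. u \<in> U \<and> v \<in> V}"

text \<open>\<open>nested g [p\<^sub>1, \<dots>, p\<^sub>m]\<close> is \<open>g p\<^sub>m (\<dots> (g p\<^sub>2 p\<^sub>1) \<dots>)\<close>, and \<open>p\<^sub>1\<close> if \<open>m = 1\<close>;
  it is only used for nonempty lists.\<close>

definition nested :: "('a \<Rightarrow> 'a \<Rightarrow> 'a) \<Rightarrow> 'a list \<Rightarrow> 'a" where
  "nested g ps = fold g (tl ps) (hd ps)"

lemma join_minus_props:
  shows "suffix (join_minus u v) u" "subseq (join_minus u v) v"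
    and "suffix s u \<Longrightarrow> subseq s v \<Longrightarrow> length s \<le> length (join_minus u v)"
proof -
  let ?P = "\<lambda>s. suffix s u \<and> subseq s v"
  have "?P []" by simp
  moreover have "\<forall>s. ?P s \<longrightarrow> length s < Suc (length u)"
    by (auto simp: less_Suc_eq_le suffix_length_le)
  ultimately have "?P (join_minus u v) \<and> (\<forall>s. ?P s \<longrightarrow> length s \<le> length (join_minus u v))"
    unfolding join_minus_def by (rule arg_max_nat_lemma)
  then show "suffix (join_minus u v) u" "subseq (join_minus u v) v"
    "suffix s u \<Longrightarrow> subseq s v \<Longrightarrow> length s \<le> length (join_minus u v)"
    by blast+
qed

lemma join_plus_minus: "join_plus u v @ join_minus u v = u"
proof -
  obtain zs where "u = zs @ join_minus u v"
    using join_minus_props(1)[of u v] by (auto simp: suffix_def)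
  then have "length zs = length u - length (join_minus u v)"
    by (metis add_diff_cancel_right' length_append)
  with \<open>u = zs @ join_minus u v\<close> show ?thesis
    unfolding join_plus_def by (metis append_eq_conv_conj)
qed


section \<open>The update system\<close>

text \<open>\<open>state_set n i\<close> is \<open>S\<^sub>i\<close>, only meant for \<open>i \<in> {1..n}\<close>. As \<^const>\<open>nested\<close> returns the
  entry of a one-element list, the first branch also covers
  \<open>S\<^bsub>n-1\<^esub> = {\<star>, a\<^bsub>n-1\<^esub>, a\<^bsub>n-1\<^esub> a\<^sub>n}\<close>.\<close>

function state_set :: "nat \<Rightarrow> nat \<Rightarrow> word set" where
  "state_set n i =
     (if i < n then insert [] ((#) i ` nested set_join (map (state_set n) [Suc i..<Suc n]))
      else {[], [n]})"
  by auto
termination by (relation "Wellfounded.measure (\<lambda>(n, i). n - i)") auto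

declare state_set.simps [simp del]

text \<open>The arrows of the base graph go from \<open>i\<close> to all \<open>j > i\<close>, so the vertex function
  \<open>f\<^sub>i\<close> reads only the components \<open>s\<^bsub>i+1\<^esub>, \<dots>, s\<^sub>n\<close> of the state.\<close>

definition vertex_fun :: "nat \<Rightarrow> nat \<Rightarrow> (nat \<Rightarrow> word) \<Rightarrow> word" where
  "vertex_fun n i s =
     (if i < n then i # nested word_join (map s [Suc i..<Suc n]) else [n])"

text \<open>System states and maps between them are extensional functions (undefined outside
  their domain), so that equality of maps is equality on \<open>states n\<close>.\<close>

definition states :: "nat \<Rightarrow> (nat \<Rightarrow> word) set" where
  "states n = (\<Pi>\<^sub>E i\<in>{1..n}. state_set n i)"

definition star_state :: "nat \<Rightarrow> nat \<Rightarrow> word" where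
  "star_state n = (\<lambda>i\<in>{1..n}. [])"

definition local_fun :: "nat \<Rightarrow> nat \<Rightarrow> (nat \<Rightarrow> word) \<Rightarrow> (nat \<Rightarrow> word)" where
  "local_fun n i = (\<lambda>s\<in>states n. s(i := vertex_fun n i s))"

fun evolution :: "nat \<Rightarrow> word \<Rightarrow> (nat \<Rightarrow> word) \<Rightarrow> (nat \<Rightarrow> word)" where
  "evolution n [] = (\<lambda>s\<in>states n. s)"
| "evolution n (i # w) = compose (states n) (local_fun n i) (evolution n w)"

definition dynamics_monoid :: "nat \<Rightarrow> ((nat \<Rightarrow> word) \<Rightarrow> (nat \<Rightarrow> word)) monoid" where
  "dynamics_monoid n =
     \<lparr>carrier = evolution n ` words n,
      mult = compose (states n),
      one = (\<lambda>s\<in>states n. s)\<rparr>"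

lemma word_join_mem: "u \<in> U \<Longrightarrow> v \<in> V \<Longrightarrow> word_join u v \<in> set_join U V"
  unfolding set_join_def by blast

lemma nested_set_join_mem:
  assumes "xs \<noteq> []" "\<And>x. x \<in> set xs \<Longrightarrow> s x \<in> T x"
  shows "nested word_join (map s xs) \<in> nested set_join (map T xs)"
proof -
  have "fold word_join (map s ys) a \<in> fold set_join (map T ys) B"
    if "a \<in> B" "\<forall>y\<in>set ys. s y \<in> T y" for a B ys
    using that by (induction ys arbitrary: a B) (simp_all add: word_join_mem)
  with assms show ?thesis by (cases xs) (simp_all add: nested_def)
qed

lemma star_state_in_states: "star_state n \<in> states n"
proof -
  have "[] \<in> state_set n i" for i by (subst state_set.simps) simp
  then show ?thesis by (auto simp: star_state_def states_def)
qed

lemma vertex_fun_in_state_set: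
  assumes "i \<in> {1..n}" "s \<in> states n"
  shows "vertex_fun n i s \<in> state_set n i"
proof (cases "i < n")
  case True
  have "nested word_join (map s [Suc i..<Suc n]) \<in> nested set_join (map (state_set n) [Suc i..<Suc n])"
    using assms True by (intro nested_set_join_mem) (auto simp: states_def)
  with True show ?thesis by (subst state_set.simps) (simp add: vertex_fun_def)
next
  case False
  with assms show ?thesis by (subst state_set.simps) (simp add: vertex_fun_def)
qed

lemma local_fun_in_states:
  "i \<in> {1..n} \<Longrightarrow> s \<in> states n \<Longrightarrow> local_fun n i s \<in> states n"
  using vertex_fun_in_state_set[of i n s]
  by (auto simp: local_fun_def states_def PiE_iff extensional_def)

lemma evolution_in_states:
  "w \<in> words n \<Longrightarrow> s \<in> states n \<Longrightarrow> evolution n w s \<in> states n"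
  by (induction w) (auto simp: words_def compose_def intro!: local_fun_in_states)

lemma evolution_append:
  assumes "u \<in> words n" "v \<in> words n"
  shows "evolution n (u @ v) = compose (states n) (evolution n u) (evolution n v)"
  using assms(1)
proof (induction u)
  case Nil
  have "evolution n v s = undefined" if "s \<notin> states n" for s
    using that by (cases v) (auto simp: compose_def)
  with assms(2) show ?case by (auto simp: compose_def fun_eq_iff evolution_in_states)
next
  case (Cons i u)
  then have IH: "evolution n (u @ v) = compose (states n) (evolution n u) (evolution n v)"
    by (simp add: words_def)
  show ?case
  proof
    fix s
    show "evolution n ((i # u) @ v) s =
      compose (states n) (evolution n (i # u)) (evolution n v) s"
      by (cases "s \<in> states n") (simp_all add: IH compose_def evolution_in_states[OF assms(2)])
  qed
qed

lemma monoid_dynamics_monoid: "monoid (dynamics_monoid n)"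
proof -
  have car: "carrier (dynamics_monoid n) = evolution n ` words n"
    and one: "\<one>\<^bsub>dynamics_monoid n\<^esub> = evolution n []"
    by (simp_all add: dynamics_monoid_def)
  have mult: "evolution n u \<otimes>\<^bsub>dynamics_monoid n\<^esub> evolution n v = evolution n (u @ v)"
    if "u \<in> words n" "v \<in> words n" for u v
    using that by (simp add: dynamics_monoid_def evolution_append)
  have app: "u @ v \<in> words n" if "u \<in> words n" "v \<in> words n" for u v
    using that by (auto simp: words_def)
  have Nil: "[] \<in> words n" by (simp add: words_def)
  show ?thesis
  proof (rule monoidI, unfold car one)
    show "evolution n [] \<in> evolution n ` words n" using Nil by (rule imageI)
  next
    fix x y assume "x \<in> evolution n ` words n" "y \<in> evolution n ` words n"
    then obtain u v where "u \<in> words n" "v \<in> words n" "x = evolution n u" "y = evolution n v"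
      by blast
    then show "x \<otimes>\<^bsub>dynamics_monoid n\<^esub> y \<in> evolution n ` words n"
      by (simp only: mult) (intro imageI app)
  next
    fix x y z
    assume "x \<in> evolution n ` words n" "y \<in> evolution n ` words n" "z \<in> evolution n ` words n"
    then obtain u v w where "u \<in> words n" "v \<in> words n" "w \<in> words n"
      "x = evolution n u" "y = evolution n v" "z = evolution n w"
      by blast
    then show "x \<otimes>\<^bsub>dynamics_monoid n\<^esub> y \<otimes>\<^bsub>dynamics_monoid n\<^esub> z =
        x \<otimes>\<^bsub>dynamics_monoid n\<^esub> (y \<otimes>\<^bsub>dynamics_monoid n\<^esub> z)"
      by (simp only: mult app append_assoc)
  next
    fix x assume "x \<in> evolution n ` words n"
    then obtain u where "u \<in> words n" "x = evolution n u" by blast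
    then show "evolution n [] \<otimes>\<^bsub>dynamics_monoid n\<^esub> x = x"
      "x \<otimes>\<^bsub>dynamics_monoid n\<^esub> evolution n [] = x"
      by (simp_all only: mult Nil append_Nil append_Nil2)
  qed
qed

end

theory Submission
  imports Defs
begin

text \<open>The defining relations of Kiselman's semigroup hold for the local functions because
  \<open>f\<^sub>i\<close> reads only components above \<open>i\<close>, so evolutions depend only on classes. Everything else
  follows once a canonical word \<open>w\<close> can be read off from the final state: this also gives
  uniqueness of canonical words. For canonical \<open>w\<close>, the join of the first \<open>k\<close> components is the
  suffix of \<open>w\<close> starting at the first letter \<open>\<le> k\<close>. If this suffix is \<open>a\<^sub>k z v\<close>, with \<open>v\<close>
  starting at the first letter \<open>< k\<close>, then the \<open>k\<close>-th component is, by downward induction, \<open>a\<^sub>k\<close>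
  followed by the canonical form of the letters \<open>> k\<close> of \<open>z v\<close>, which is \<open>z c\<close> for a
  quasi-subword \<open>c\<close> of \<open>v\<close>. The suffix \<open>c\<close> is the longest one the join can remove, since the
  strict left-to-right maxima of \<open>d c\<close>, with \<open>d\<close> the last letter of \<open>a\<^sub>k z\<close>, are those of
  \<open>d v\<close>, and these never form a quasi-subword of \<open>v\<close>.\<close>

declare One_nat_def [simp del]

section \<open>Joins\<close>

text \<open>A removed suffix longer than \<open>y\<close> has the form \<open>t @ y\<close> with
  \<open>t\<close> a nonempty suffix of \<open>x\<close>, so it contains \<open>last x # y\<close>;
  hence only this one-letter extension has to be excluded.\<close>

lemma word_join_eqI:
  assumes "subseq y v" and "x \<noteq> [] \<Longrightarrow> \<not> subseq (last x # y) v"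
  shows "word_join (x @ y) v = x @ v"
proof -
  let ?m = "join_minus (x @ y) v"
  note props = join_minus_props[where u = "x @ y" and v = v]
  have "length y \<le> length ?m"
    using assms(1) by (intro props(3)) (auto simp: suffix_def)
  moreover have "suffix y (x @ y)" by (simp add: suffix_def)
  ultimately have "suffix y ?m"
    using props(1) suffix_length_suffix by blast
  then obtain t where t: "?m = t @ y" by (auto simp: suffix_def)
  then have "suffix t x" using props(1) by simp
  have "t = []"
  proof (rule ccontr)
    assume "t \<noteq> []"
    with \<open>suffix t x\<close> have "x \<noteq> []" "last x = last t" by (auto simp: suffix_def)
    moreover have "?m = butlast t @ last t # y" using t \<open>t \<noteq> []\<close> by simp
    then have "subseq (last t # y) ?m" by (metis list_emb_append2 subseq_order.refl)
    ultimately show False using assms(2) props(2) by (metis subseq_order.trans)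
  qed
  with t show ?thesis by (simp add: word_join_def join_plus_def)
qed

lemma subseq_set: "subseq u v \<Longrightarrow> set u \<subseteq> set v"
  by (auto elim: list_emb_set)

lemma word_join_Nil_right: "word_join u [] = u"
  using word_join_eqI[of "[]" "[]" u] by simp

lemma word_join_subseq: "subseq u v \<Longrightarrow> word_join u v = v"
  using word_join_eqI[of u v "[]"] by simp

lemma nested_word_join:
  assumes "xs \<noteq> []"
  shows "nested word_join xs = fold word_join xs []"
  using assms by (cases xs) (simp_all add: nested_def word_join_Nil_right)


section \<open>Evolutions of the star state\<close>

text \<open>This is \<open>local_fun\<close> without the restriction to \<open>states n\<close>, so
  that it acts on arbitrary functions.\<close>

definition step :: "nat \<Rightarrow> nat \<Rightarrow> (nat \<Rightarrow> word) \<Rightarrow> (nat \<Rightarrow> word)" where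
  "step n i s = s(i := vertex_fun n i s)"

lemma step_same: "step n i s i = vertex_fun n i s"
  by (simp add: step_def)

lemma step_other: "k \<noteq> i \<Longrightarrow> step n i s k = s k"
  by (simp add: step_def)

text \<open>The empty word is a right identity of the join, so starting from it gives every
  component the same role. For \<open>m > n\<close> the result is empty, which makes the constant
  function at vertex \<open>n\<close> an instance of the general formula.\<close>

definition join_from :: "nat \<Rightarrow> nat \<Rightarrow> (nat \<Rightarrow> word) \<Rightarrow> word" where
  "join_from n m s = fold word_join (map s [m..<Suc n]) []"

text \<open>The run starts from the constant empty word, whereas \<open>star_state\<close> is
  undefined outside \<open>{1..n}\<close>; the two agree on all components that are read.\<close>

definition star_run :: "nat \<Rightarrow> word \<Rightarrow> nat \<Rightarrow> word" where
  "star_run n w = foldr (step n) w (\<lambda>_. [])"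

lemma star_run_Nil [simp]: "star_run n [] k = []"
  by (simp add: star_run_def)

lemma star_run_Cons: "star_run n (i # w) = step n i (star_run n w)"
  by (simp add: star_run_def)

lemma join_from_cong: "(\<And>k. m \<le> k \<Longrightarrow> k \<le> n \<Longrightarrow> s k = t k) \<Longrightarrow> join_from n m s = join_from n m t"
  unfolding join_from_def by (intro arg_cong[of _ _ "\<lambda>xs. fold word_join xs []"]) auto

lemma vertex_fun_eq:
  assumes "i \<le> n"
  shows "vertex_fun n i s = i # join_from n (Suc i) s"
  using assms by (auto simp: vertex_fun_def join_from_def nested_word_join simp del: upt_Suc)

lemma vertex_fun_cong:
  assumes "\<And>k. i < k \<Longrightarrow> s k = t k"
  shows "vertex_fun n i s = vertex_fun n i t"
proof -
  have "map s [Suc i..<Suc n] = map t [Suc i..<Suc n]"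
    using assms by auto
  then show ?thesis by (simp only: vertex_fun_def)
qed

lemma evolution_eq_foldr:
  assumes "w \<in> words n" "s \<in> states n"
  shows "evolution n w s = foldr (step n) w s"
  using assms
proof (induction w)
  case (Cons i w)
  then have "w \<in> words n" by (simp add: words_def)
  with Cons show ?case
    using evolution_in_states[of w n s] by (simp add: compose_def local_fun_def step_def)
qed simp

lemma evolution_outside: "s \<notin> states n \<Longrightarrow> evolution n w s = undefined"
  by (cases w) (auto simp: compose_def)

lemma foldr_step_cong:
  assumes "\<And>k. m \<le> k \<Longrightarrow> k \<le> n \<Longrightarrow> s k = t k" "set w \<subseteq> {1..n}" "m \<le> k" "k \<le> n"
  shows "foldr (step n) w s k = foldr (step n) w t k"
  using assms(2-)
proof (induction w arbitrary: k)
  case (Cons i w)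
  then have "join_from n (Suc i) (foldr (step n) w s) = join_from n (Suc i) (foldr (step n) w t)"
    if "i = k"
    using that by (intro join_from_cong) auto
  with Cons show ?case by (cases "i = k") (simp_all add: step_same step_other vertex_fun_eq)
qed (use assms(1) in auto)

lemma evolution_star_state:
  assumes "w \<in> words n" "k \<in> {1..n}"
  shows "evolution n w (star_state n) k = star_run n w k"
  unfolding evolution_eq_foldr[OF assms(1) star_state_in_states] star_run_def
  using assms by (intro foldr_step_cong[of 1]) (auto simp: star_state_def words_def)

lemma star_run_not_in: "k \<notin> set w \<Longrightarrow> star_run n w k = []"
  by (induction w) (auto simp: star_run_Cons step_def)

text \<open>Letters act from right to left and an update overwrites, so the leftmost
  \<open>k\<close> alone sets component \<open>k\<close>, reading the state that \<open>b\<close>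
  has produced.\<close>

lemma star_run_first:
  assumes "k \<notin> set a" "k \<le> n"
  shows "star_run n (a @ k # b) k = k # join_from n (Suc k) (star_run n b)"
  using assms by (induction a) (auto simp: star_run_Cons step_def vertex_fun_eq)

text \<open>Each vertex reads only larger ones, so updates below \<open>m\<close> are invisible from
  \<open>m\<close> on.\<close>

lemma star_run_filter:
  assumes "k \<ge> m"
  shows "star_run n (filter (\<lambda>x. m \<le> x) w) k = star_run n w k"
  using assms
proof (induction w arbitrary: k)
  case (Cons i w)
  then have "vertex_fun n i (star_run n (filter (\<lambda>x. m \<le> x) w)) = vertex_fun n i (star_run n w)"
    if "m \<le> i"
    using that by (intro vertex_fun_cong) auto
  with Cons show ?case by (auto simp: star_run_Cons step_def)
qed simp


section \<open>Kiselman's congruence\<close>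

abbreviation kiselman_cong :: "nat \<Rightarrow> (word \<times> word) set" where
  "kiselman_cong n \<equiv> pres_cong {1..n} (kiselman_rels n)"

lemma kiselman_cong_context:
  assumes "(u, v) \<in> kiselman_cong n" "x \<in> words n" "y \<in> words n"
  shows "(x @ u @ y, x @ v @ y) \<in> kiselman_cong n"
  using pres_cong.ctxt assms by (simp add: words_def)

text \<open>Let \<open>i < j\<close>; vertex \<open>j\<close> does not read component
  \<open>i\<close>. In \<open>i j i\<close> the first update of \<open>i\<close> is unseen by
  \<open>j\<close> and then overwritten; in \<open>j i j\<close> the second update of
  \<open>j\<close> recomputes the same value.\<close>

lemma foldr_step_kiselman_cong:
  "(u, v) \<in> kiselman_cong n \<Longrightarrow> foldr (step n) u s = foldr (step n) v s"
proof (induction arbitrary: s rule: pres_cong.induct)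
  case (rel u v)
  have "step n i (step n i s) = step n i s" for i
    using vertex_fun_cong[of i "step n i s" s] by (simp add: step_def)
  moreover have "step n i (step n j (step n i s)) = step n i (step n j s)"
    "step n j (step n i (step n j s)) = step n i (step n j s)" if "i < j" for i j
  proof -
    have "vertex_fun n j (s(i := x)) = vertex_fun n j s" for x
      using that by (intro vertex_fun_cong) auto
    moreover have "vertex_fun n i (s(i := x, j := y)) = vertex_fun n i (s(j := y))" for x y
      using that by (intro vertex_fun_cong) auto
    ultimately show "step n i (step n j (step n i s)) = step n i (step n j s)"
      using that by (simp add: step_def fun_upd_twist)
    have "vertex_fun n j (s(j := x, i := y)) = vertex_fun n j s" for x y
      using that by (intro vertex_fun_cong) auto
    then show "step n j (step n i (step n j s)) = step n i (step n j s)"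
      using that by (auto simp: step_def fun_eq_iff)
  qed
  ultimately show ?case using rel by (auto simp: kiselman_rels_def)
qed simp_all

lemma evolution_kiselman_cong:
  assumes "(u, v) \<in> kiselman_cong n"
  shows "evolution n u = evolution n v"
proof
  fix s
  have "u \<in> words n" "v \<in> words n"
    using pres_cong_in_lists[OF assms] by (auto simp: words_def)
  then show "evolution n u s = evolution n v s"
    using foldr_step_kiselman_cong[OF assms]
    by (cases "s \<in> states n") (simp_all add: evolution_eq_foldr evolution_outside)
qed

section \<open>Deleting an end of a repetition that is not special\<close>

lemma kiselman_cong_idem: "i \<in> {1..n} \<Longrightarrow> ([i, i], [i]) \<in> kiselman_cong n"
  by (rule pres_cong.rel) (auto simp: kiselman_rels_def)

lemma kiselman_cong_up:
  assumes "i \<in> {1..n}" "j \<in> {1..n}" "i \<le> j"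
  shows "([i, j, i], [i, j]) \<in> kiselman_cong n"
proof (cases "i = j")
  case True
  with assms kiselman_cong_context[OF kiselman_cong_idem, of i n "[]" "[i]"] show ?thesis
    by (simp add: words_def)
next
  case False
  with assms show ?thesis by (intro pres_cong.rel) (auto simp: kiselman_rels_def)
qed

lemma kiselman_cong_down:
  assumes "i \<in> {1..n}" "j \<in> {1..n}" "j \<le> i"
  shows "([i, j, i], [j, i]) \<in> kiselman_cong n"
proof (cases "i = j")
  case True
  with assms kiselman_cong_up[of i n i] show ?thesis by simp
next
  case False
  with assms show ?thesis by (intro pres_cong.rel) (auto simp: kiselman_rels_def)
qed

text \<open>If \<open>j\<close> is the last letter of \<open>u\<close>, the induction hypothesis
  inserts an \<open>i\<close> before it, the relation \<open>i j i = i j\<close> removes the final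
  \<open>i\<close>, and the inserted one is removed again.\<close>

lemma kiselman_cong_delete_right:
  assumes "i \<in> {1..n}" "u \<in> words n" "\<forall>j\<in>set u. i \<le> j"
  shows "(i # u @ [i], i # u) \<in> kiselman_cong n"
  using assms
proof (induction u rule: rev_induct)
  case Nil
  then show ?case by (simp add: kiselman_cong_idem)
next
  case (snoc j u)
  then have IH: "(i # u @ [i], i # u) \<in> kiselman_cong n" and j: "j \<in> {1..n}" "i \<le> j"
    and w: "i # u \<in> words n" "u \<in> words n"
    by (auto simp: words_def)
  have l: "[] \<in> words n" "[i] \<in> words n" "[j] \<in> words n" "[j, i] \<in> words n"
    using j snoc.prems(1) by (auto simp: words_def)
  have "(i # u @ [j, i], i # u @ [i, j, i]) \<in> kiselman_cong n"
    using kiselman_cong_context[OF pres_cong.sym[OF IH] l(1) l(4)] by simp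
  moreover have "(i # u @ [i, j, i], i # u @ [i, j]) \<in> kiselman_cong n"
    using kiselman_cong_context[OF kiselman_cong_up w(1) l(1)] j snoc.prems(1) by simp
  moreover have "(i # u @ [i, j], i # u @ [j]) \<in> kiselman_cong n"
    using kiselman_cong_context[OF IH l(1) l(3)] by simp
  ultimately show ?case by (simp, blast intro: pres_cong.trans)
qed

text \<open>Mirror image of the deletion on the right, by induction on the first letter of
  \<open>u\<close> and with the relation \<open>i j i = j i\<close>.\<close>

lemma kiselman_cong_delete_left:
  assumes "i \<in> {1..n}" "u \<in> words n" "\<forall>j\<in>set u. j \<le> i"
  shows "(i # u @ [i], u @ [i]) \<in> kiselman_cong n"
  using assms
proof (induction u)
  case Nil
  then show ?case by (simp add: kiselman_cong_idem)
next
  case (Cons j u)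
  then have IH: "(i # u @ [i], u @ [i]) \<in> kiselman_cong n" and j: "j \<in> {1..n}" "j \<le> i"
    and w: "u @ [i] \<in> words n"
    by (auto simp: words_def)
  have l: "[] \<in> words n" "[j] \<in> words n" "[i, j] \<in> words n"
    using j Cons.prems(1) by (auto simp: words_def)
  have "(i # j # u @ [i], i # j # i # u @ [i]) \<in> kiselman_cong n"
    using kiselman_cong_context[OF pres_cong.sym[OF IH] l(3) l(1)] by simp
  moreover have "(i # j # i # u @ [i], j # i # u @ [i]) \<in> kiselman_cong n"
    using kiselman_cong_context[OF kiselman_cong_down l(1) w] j Cons.prems(1) by simp
  moreover have "(j # i # u @ [i], j # u @ [i]) \<in> kiselman_cong n"
    using kiselman_cong_context[OF IH l(2) l(1)] by simp
  ultimately show ?case by (simp, blast intro: pres_cong.trans)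
qed

lemma canonicalD: "canonical w \<Longrightarrow> w = a @ i # u @ i # b \<Longrightarrow> special i u"
  unfolding canonical_def sublist_def by fastforce

lemma not_canonicalE:
  assumes "\<not> canonical w"
  obtains a i u b where "w = a @ i # u @ i # b" "\<not> special i u"
  using assms unfolding canonical_def sublist_def by auto

lemma canonical_appendD:
  assumes "canonical (u @ v)"
  shows "canonical u" "canonical v"
proof -
  have "sublist u (u @ v)" "sublist v (u @ v)" by simp_all
  with assms show "canonical u" "canonical v"
    unfolding canonical_def by (blast intro: sublist_order.order.trans)+
qed

text \<open>A repetition that is not special has no smaller or no larger letter inside, so its right
  or its left end can be deleted within the class. This shortens the word and leaves a
  quasi-subword.\<close>

lemma canonical_representative:
  assumes "w \<in> words n"
  obtains c where "canonical c" "subseq c w" "(w, c) \<in> kiselman_cong n"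
  using assms
proof (induction w arbitrary: thesis rule: length_induct)
  case (1 w)
  show ?case
  proof (cases "canonical w")
    case True
    have "(w, w) \<in> kiselman_cong n"
      using 1(3) by (intro pres_cong.refl) (simp add: words_def)
    with 1(2) True show ?thesis by blast
  next
    case False
    then obtain a i u b where w: "w = a @ i # u @ i # b" and ns: "\<not> special i u"
      by (rule not_canonicalE)
    have mem: "a \<in> words n" "i \<in> {1..n}" "u \<in> words n" "b \<in> words n"
      using 1(3) by (auto simp: w words_def)
    have "\<exists>v. length v < length w \<and> subseq v w \<and> (w, v) \<in> kiselman_cong n"
    proof (cases "\<forall>j\<in>set u. i \<le> j")
      case True
      show ?thesis
        using kiselman_cong_context[OF kiselman_cong_delete_right[OF mem(2,3) True] mem(1,4)]
        by (intro exI[of _ "a @ i # u @ b"]) (simp add: w subseq_append' list_emb_Cons)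
    next
      case False
      with ns have *: "\<forall>j\<in>set u. j \<le> i" by (fastforce simp: special_def)
      show ?thesis
        using kiselman_cong_context[OF kiselman_cong_delete_left[OF mem(2,3) *] mem(1,4)]
        by (intro exI[of _ "a @ u @ i # b"]) (simp add: w subseq_append' list_emb_Cons)
    qed
    then obtain v where v: "length v < length w" "subseq v w" "(w, v) \<in> kiselman_cong n"
      by blast
    then have "v \<in> words n" by (auto simp: words_def dest: pres_cong_in_lists)
    with 1(1) v(1) obtain c where "canonical c" "subseq c v" "(v, c) \<in> kiselman_cong n"
      by metis
    with v 1(2) show ?thesis by (meson pres_cong.trans subseq_order.trans)
  qed
qed


section \<open>Strict left-to-right maxima\<close>

function records :: "'a::linorder list \<Rightarrow> 'a list" where
  "records [] = []"
| "records (x # xs) = x # records (filter (\<lambda>y. x < y) xs)"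
  by pat_completeness auto
termination by (relation "Wellfounded.measure length") (simp_all add: le_imp_less_Suc)

lemma subseq_records: "subseq (records w) w"
proof (induction w rule: records.induct)
  case (2 x xs)
  then have "subseq (records (filter (\<lambda>y. x < y) xs)) xs"
    by (rule subseq_order.trans) simp
  then show ?case by simp
qed simp

text \<open>A copy of an earlier letter neither is a strict maximum nor changes the running
  maximum.\<close>

lemma records_delete:
  "l \<in> set p \<Longrightarrow> records (p @ l # q) = records (p @ q)"
proof (induction p arbitrary: q rule: records.induct)
  case (2 x xs)
  show ?case
  proof (cases "x < l")
    case True
    with 2 show ?thesis by auto
  qed simp
qed simp

lemma filter_eq_appendD:
  "filter P w = u @ v \<Longrightarrow> \<exists>u' v'. w = u' @ v' \<and> filter P u' = u \<and> filter P v' = v"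
proof (induction w arbitrary: u)
  case (Cons x w)
  show ?case
  proof (cases "P x \<and> u = []")
    case True
    with Cons.prems show ?thesis by (intro exI[of _ "[]"] exI[of _ "x # w"]) simp
  next
    case False
    let ?u = "if P x then tl u else u"
    have "filter P w = ?u @ v" using Cons.prems False by (cases u) (auto split: if_splits)
    then obtain u' v' where "w = u' @ v'" "filter P u' = ?u" "filter P v' = v"
      using Cons.IH by blast
    with Cons.prems False show ?thesis
      by (intro exI[of _ "x # u'"] exI[of _ v']) (cases u; auto split: if_splits)
  qed
qed simp

text \<open>Pulls a repetition in a restricted word back to the full word, where canonicity or
  separation supplies letters between its ends.\<close>

lemma filter_repeatE:
  assumes "filter P w = a @ i # u @ i # b"
  obtains a' u' b' where "w = a' @ i # u' @ i # b'" "filter P u' = u" "P i"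
proof -
  from assms obtain p q where 1: "w = p @ q" "filter P q = i # u @ i # b"
    by (blast dest: filter_eq_appendD)
  from 1(2) obtain q1 q2 where 2: "q = q1 @ i # q2" "P i" "filter P q2 = u @ i # b"
    unfolding filter_eq_Cons_iff by metis
  from 2(3) obtain r1 r2 where 3: "q2 = r1 @ r2" "filter P r1 = u" "filter P r2 = i # b"
    by (blast dest: filter_eq_appendD)
  from 3(3) obtain t1 t2 where 4: "r2 = t1 @ i # t2" "\<forall>x\<in>set t1. \<not> P x"
    unfolding filter_eq_Cons_iff by metis
  have "w = (p @ q1) @ i # (r1 @ t1) @ i # t2" by (simp add: 1 2 3 4)
  moreover have "filter P (r1 @ t1) = u" using 3 4 by (simp add: filter_empty_conv)
  ultimately show thesis using 2(2) that by blast
qed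

text \<open>The half of canonicity that survives the removal of small letters.\<close>

definition separated :: "'a::linorder list \<Rightarrow> bool" where
  "separated w \<longleftrightarrow> (\<forall>a i u b. w = a @ i # u @ i # b \<longrightarrow> (\<exists>j\<in>set u. i < j))"

lemma separated_filter:
  assumes "separated w"
  shows "separated (filter (\<lambda>x. l < x) w)"
  unfolding separated_def
proof (intro allI impI)
  fix a i u b
  assume "filter (\<lambda>x. l < x) w = a @ i # u @ i # b"
  then obtain a' u' b' where *: "w = a' @ i # u' @ i # b'" "filter (\<lambda>x. l < x) u' = u" "l < i"
    by (rule filter_repeatE)
  with assms obtain j where "j \<in> set u'" "i < j" unfolding separated_def by blast
  with * show "\<exists>j\<in>set u. i < j" by auto
qed

text \<open>Applied with \<open>x\<close> a single letter; the induction needs general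
  \<open>x\<close>. The first maximum \<open>l\<close>, the head of \<open>x\<close>, is matched
  with a later \<open>l\<close> in \<open>y\<close>, and the other maxima exceed \<open>l\<close>
  and embed after it. By the induction hypothesis for the letters above \<open>l\<close>, none of
  these lies between the two copies of \<open>l\<close>, against separation.\<close>

lemma separated_records:
  assumes "separated (x @ y)" "subseq (records (x @ y)) y"
  shows "x = []"
  using assms
proof (induction "length (x @ y)" arbitrary: x y rule: less_induct)
  case less
  show ?case
  proof (rule ccontr)
    assume "x \<noteq> []"
    then obtain l t where x: "x = l # t" by (cases x) auto
    let ?f = "filter (\<lambda>z. l < z)"
    have "subseq (l # records (?f (t @ y))) y"
      using less.prems(2) by (simp add: x)
    then obtain y1 y2 where y: "y = y1 @ l # y2" and sub: "subseq (records (?f (t @ y))) y2"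
      by (auto dest: list_emb_ConsD)
    have "set (records (?f (t @ y))) \<subseteq> set (?f (t @ y))"
      using subseq_records by (metis subseq_set)
    then have "?f (records (?f (t @ y))) = records (?f (t @ y))"
      by (auto intro!: filter_True)
    then have "subseq (records (?f (t @ y))) (?f y2)"
      using sub by (metis subseq_filter)
    moreover have eq: "?f (t @ y) = ?f (t @ y1) @ ?f y2" by (simp add: y)
    moreover have "separated (?f (l # t @ y))"
      using less.prems(1) by (intro separated_filter) (simp add: x)
    then have "separated (?f (t @ y1) @ ?f y2)" by (simp add: y)
    moreover have "length (?f (t @ y1) @ ?f y2) < length (x @ y)"
      using length_filter_le[of "\<lambda>z. l < z" "t @ y1"] length_filter_le[of "\<lambda>z. l < z" y2]
      by (simp add: x y del: filter_append length_filter_le)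
    ultimately have "?f (t @ y1) = []"
      using less.hyps by metis
    moreover have "\<exists>j\<in>set (t @ y1). l < j"
      using less.prems(1) unfolding separated_def x y by (metis append.assoc append_Cons append_Nil)
    ultimately show False by (auto simp: filter_empty_conv)
  qed
qed

lemma canonical_separated: "canonical w \<Longrightarrow> separated w"
  unfolding separated_def by (auto dest!: canonicalD simp: special_def)


section \<open>Canonical words of restrictions\<close>

lemma append_Cons_eq_appendE:
  assumes "x @ j # e = t @ b"
  obtains s where "x = t @ s" "b = s @ j # e" | s where "t = x @ j # s" "e = s @ b"
  using assms by (auto simp: append_eq_append_conv2 Cons_eq_append_conv)

text \<open>Equivalently, a repetition that is not special has no smaller letter inside, so that its
  right end can be deleted.\<close>

definition right_reducible :: "word \<Rightarrow> bool" where
  "right_reducible w \<longleftrightarrow>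
     (\<forall>a i u b. w = a @ i # u @ i # b \<longrightarrow> (\<exists>j\<in>set u. i < j) \<or> (\<forall>j\<in>set u. i \<le> j))"

text \<open>The larger letter inside a special subword survives the restriction, even if the smaller
  one does not.\<close>

lemma right_reducible_filter:
  assumes "canonical w"
  shows "right_reducible (filter (\<lambda>x. l \<le> x) w)"
  unfolding right_reducible_def
proof (intro allI impI disjI1)
  fix a i u b
  assume "filter (\<lambda>x. l \<le> x) w = a @ i # u @ i # b"
  then obtain a' u' b' where *: "w = a' @ i # u' @ i # b'" "filter (\<lambda>x. l \<le> x) u' = u" "l \<le> i"
    by (rule filter_repeatE)
  with assms obtain j where "j \<in> set u'" "i < j" by (auto dest!: canonicalD simp: special_def)
  with * show "\<exists>j\<in>set u. i < j" by auto
qed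

lemma right_reducible_delete:
  assumes rr: "right_reducible (a @ l # u @ l # b)" and u: "\<forall>j\<in>set u. l \<le> j"
  shows "right_reducible (a @ l # u @ b)"
  unfolding right_reducible_def
proof (intro allI impI)
  fix c j x e
  assume eq: "a @ l # u @ b = c @ j # x @ j # e"
  have rrD: "(\<exists>k\<in>set x. j < k) \<or> (\<forall>k\<in>set x. j \<le> k)"
    if "a @ l # u @ l # b = c @ j # x @ j # e" for c x e
    using rr that unfolding right_reducible_def by blast
  let ?p = "a @ l # u"
  have "?p @ b = c @ j # x @ j # e" using eq by simp
  from this[symmetric] show "(\<exists>k\<in>set x. j < k) \<or> (\<forall>k\<in>set x. j \<le> k)"
  proof (cases rule: append_Cons_eq_appendE)
    case (1 t)
    then show ?thesis by (intro rrD[of "?p @ l # t" x e]) simp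
  next
    case (2 t)
    from 2(2) show ?thesis
    proof (cases rule: append_Cons_eq_appendE)
      case (1 s)
      have "(\<exists>k\<in>set (t @ l # s). j < k) \<or> (\<forall>k\<in>set (t @ l # s). j \<le> k)"
      proof (rule rrD)
        show "a @ l # u @ l # b = c @ j # (t @ l # s) @ j # e"
          using arg_cong[OF 2(1), of "\<lambda>z. z @ l # b"] 1 by simp
      qed
      \<comment> \<open>If the deleted \<open>l\<close> was the larger letter between the two copies
        of \<open>j\<close>, the retained \<open>l\<close> also lies between them: the left
        \<open>j\<close> precedes it, because \<open>u\<close> has no letter below
        \<open>l\<close>.\<close>
      moreover have "l \<in> set t" if "j < l"
        using 2(1)
      proof (cases rule: append_Cons_eq_appendE)
        case (1 r)
        with that show ?thesis by (cases r) auto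
      next
        case (2 r)
        with u that show ?thesis by auto
      qed
      ultimately show ?thesis using 1 by auto
    next
      case inner: (2 s)
      show ?thesis
      proof (rule rrD)
        show "a @ l # u @ l # b = c @ j # x @ j # (s @ l # b)"
          using arg_cong[OF 2(1), of "\<lambda>z. z @ l # b"] inner by simp
      qed
    qed
  qed
qed

text \<open>Only right deletions occur, and these cannot reach into \<open>z\<close>. A letter above the last
  letter \<open>d\<close> of \<open>z\<close> is deleted because of an earlier occurrence inside \<open>c\<close>, so the maxima of
  \<open>d # c\<close> survive.\<close>

lemma canonical_extension:
  assumes "z @ c \<in> words n" "right_reducible (z @ c)" "canonical z" "z \<noteq> [] \<Longrightarrow> last z = d"
  obtains c' where "canonical (z @ c')" "subseq c' c" "(z @ c, z @ c') \<in> kiselman_cong n"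
    "records (d # c') = records (d # c)"
  using assms(1,2)
proof (induction c arbitrary: thesis rule: length_induct)
  case (1 c)
  show ?case
  proof (cases "canonical (z @ c)")
    case True
    have "(z @ c, z @ c) \<in> kiselman_cong n"
      using 1(3) by (intro pres_cong.refl) (simp add: words_def)
    with 1(2) True show ?thesis by blast
  next
    case False
    then obtain a l u b where zc: "z @ c = a @ l # u @ l # b" and ns: "\<not> special l u"
      by (rule not_canonicalE)
    have "(\<exists>j\<in>set u. l < j) \<or> (\<forall>j\<in>set u. l \<le> j)"
      using 1(4) unfolding right_reducible_def zc by blast
    with ns have u: "\<forall>j\<in>set u. l \<le> j"
      by (auto simp: special_def not_less)
    have mem: "a \<in> words n" "l \<in> {1..n}" "u \<in> words n" "b \<in> words n"
      using 1(3) unfolding zc by (auto simp: words_def)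
    have "(a @ l # u) @ l # b = z @ c" using zc by simp
    then show ?thesis
    proof (cases rule: append_Cons_eq_appendE)
      case (2 t)
      with assms(3) ns show ?thesis by (auto dest: canonicalD)
    next
      case split: (1 p)
      have eq: "a @ l # u @ b = z @ p @ b"
        using arg_cong[OF split(1), of "\<lambda>x. x @ b"] by simp
      have cong: "(z @ c, z @ p @ b) \<in> kiselman_cong n"
        using kiselman_cong_context[OF kiselman_cong_delete_right[OF mem(2,3) u] mem(1,4)]
        by (simp add: zc eq)
      have "right_reducible (z @ p @ b)"
        using right_reducible_delete[OF _ u, of a b] "1.prems"(3) unfolding zc eq .
      moreover have "z @ p @ b \<in> words n"
        using cong by (auto simp: words_def dest: pres_cong_in_lists)
      moreover have "length (p @ b) < length c" by (simp add: split)
      ultimately obtain c' where c': "canonical (z @ c')" "subseq c' (p @ b)"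
        "(z @ p @ b, z @ c') \<in> kiselman_cong n" "records (d # c') = records (d # p @ b)"
        using "1.IH" by metis
      have "l \<in> set p" if "d < l"
      proof (rule ccontr)
        assume np: "l \<notin> set p"
        \<comment> \<open>Otherwise the earlier \<open>l\<close> lies in \<open>z\<close>, and from
          there on \<open>z\<close> has only letters \<ge> \<open>l\<close>, so
          \<open>l \<le> d\<close>.\<close>
        obtain r where r: "z = a @ l # r" "u = r @ p"
          using split(1) by (cases rule: append_Cons_eq_appendE) (use np in auto)
        then have "d = last (l # r)" using assms(4) by auto
        then have "l \<le> d" using u r by (cases r rule: rev_cases) auto
        with that show False by simp
      qed
      \<comment> \<open>A letter \<open>l \<le> d\<close> is filtered out behind \<open>d\<close>;
        any other deleted letter repeats one in \<open>p\<close>.\<close>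
      then have "records (d # p @ b) = records (d # c)"
        by (cases "d < l") (simp_all add: split records_delete)
      moreover have "subseq (p @ b) c" by (simp add: split subseq_append' list_emb_Cons)
      ultimately show ?thesis
        using "1.prems"(1) c' cong by (metis pres_cong.trans subseq_order.trans)
    qed
  qed
qed


section \<open>Reading off a canonical word\<close>

text \<open>Components from \<open>m\<close> on see only the letters from \<open>m\<close> on, so
  the restricted word may be exchanged for a congruent canonical one.\<close>

lemma join_from_star_run_cong:
  assumes "(filter (\<lambda>x. m \<le> x) w, c) \<in> kiselman_cong n"
  shows "join_from n m (star_run n w) = join_from n m (star_run n c)"
proof -
  have "star_run n (filter (\<lambda>x. m \<le> x) w) = star_run n c"
    using foldr_step_kiselman_cong[OF assms] by (simp add: star_run_def)
  then show ?thesis using star_run_filter by (intro join_from_cong) metis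
qed

text \<open>One joining step, with \<open>read\<close> as induction hypothesis for larger letters.
  The cases are: \<open>k\<close> is absent, a smaller letter precedes the first \<open>k\<close>,
  or all letters before the first \<open>k\<close> are larger.\<close>

lemma dropWhile_join:
  assumes w: "canonical w" "w \<in> words n" and k: "1 \<le> k" "k \<le> n"
    and read: "\<And>c. canonical c \<Longrightarrow> set c \<subseteq> {Suc k..n} \<Longrightarrow> join_from n (Suc k) (star_run n c) = c"
  shows "word_join (star_run n w k) (dropWhile (\<lambda>x. k \<le> x) w) = dropWhile (\<lambda>x. Suc k \<le> x) w"
proof (cases "k \<in> set w")
  case False
  then have "dropWhile (\<lambda>x. k \<le> x) w = dropWhile (\<lambda>x. Suc k \<le> x) w"
    by (intro dropWhile_cong) (auto simp: Suc_le_eq order_less_le)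
  with False show ?thesis by (simp add: star_run_not_in word_join_subseq)
next
  case True
  then obtain a b where ab: "w = a @ k # b" "k \<notin> set a" by (meson split_list_first)
  then have run: "star_run n w k = k # join_from n (Suc k) (star_run n b)"
    using k by (simp add: star_run_first)
  have b: "b \<in> words n" using w(2) ab by (auto simp: words_def)
  let ?f = "filter (\<lambda>x. Suc k \<le> x)"
  have fb: "?f b \<in> words n" using b by (auto simp: words_def)
  show ?thesis
  proof (cases "\<exists>x\<in>set a. x < k")
    \<comment> \<open>The suffix does not grow here: it already contains \<open>k # b\<close>, and
      component \<open>k\<close> is \<open>k # c\<close> with \<open>c\<close> a quasi-subword of
      \<open>b\<close>, so the join absorbs it entirely.\<close>
    case True
    then obtain x where x: "x \<in> set a" "x < k" by blast
    have "dropWhile (\<lambda>x. k \<le> x) a = dropWhile (\<lambda>x. Suc k \<le> x) a"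
      using ab(2) by (intro dropWhile_cong) (auto simp: Suc_le_eq order_less_le)
    then have d: "dropWhile (\<lambda>x. k \<le> x) w = dropWhile (\<lambda>x. Suc k \<le> x) a @ k # b"
      "dropWhile (\<lambda>x. Suc k \<le> x) w = dropWhile (\<lambda>x. Suc k \<le> x) a @ k # b"
      using x by (auto simp: ab dropWhile_append)
    obtain c where c: "canonical c" "subseq c (?f b)" "(?f b, c) \<in> kiselman_cong n"
      using canonical_representative[OF fb] .
    have "set c \<subseteq> {Suc k..n}"
      using c(2) fb by (auto simp: words_def dest!: subseq_set)
    then have "star_run n w k = k # c"
      using c(1) read join_from_star_run_cong[OF c(3)] run by simp
    moreover have "subseq c b"
      using c(2) subseq_filter_left subseq_order.trans by blast
    ultimately show ?thesis
      by (simp add: d word_join_subseq list_emb_append2)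
  next
    case False
    define z where "z = takeWhile (\<lambda>x. k \<le> x) b"
    define v where "v = dropWhile (\<lambda>x. k \<le> x) b"
    have zv: "b = z @ v" by (simp add: z_def v_def)
    \<comment> \<open>A second \<open>k\<close> in \<open>z\<close> would end a repetition without
      smaller letters inside.\<close>
    have kz: "k \<notin> set z"
    proof
      assume "k \<in> set z"
      then obtain z1 z2 where z: "z = z1 @ k # z2" by (meson split_list)
      then have "special k z1"
        using canonicalD[OF w(1), of a k z1 "z2 @ v"] by (simp add: ab zv)
      then obtain x where "x \<in> set z1" "x < k" by (auto simp: special_def)
      moreover from this z have "x \<in> set (takeWhile (\<lambda>x. k \<le> x) b)" by (simp add: z_def)
      ultimately show False by (auto dest: set_takeWhileD)
    qed
    then have zk: "\<forall>x\<in>set z. Suc k \<le> x"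
      unfolding z_def by (metis Suc_leI le_neq_implies_less set_takeWhileD)
    have ak: "\<forall>x\<in>set a. k < x" using False ab(2) by (metis linorder_neqE_nat)
    have d: "dropWhile (\<lambda>x. k \<le> x) w = v" "dropWhile (\<lambda>x. Suc k \<le> x) w = k # z @ v"
      using ak unfolding zv[symmetric] by (auto simp: ab v_def dropWhile_append)
    define e where "e = last (k # z)"
    have ke: "k \<le> e" using zk by (cases z rule: rev_cases) (auto simp: e_def)
    have can_b: "canonical b"
      using w(1) canonical_appendD(2)[of "a @ [k]" b] by (simp add: ab)
    then have can_z: "canonical z"
      unfolding zv by (rule canonical_appendD(1))
    have fz: "?f b = z @ ?f v" using zk by (simp add: zv)
    have "right_reducible (?f b)"
      using can_b by (rule right_reducible_filter)
    then obtain c where c: "canonical (z @ c)" "subseq c (?f v)"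
      "(z @ ?f v, z @ c) \<in> kiselman_cong n" "records (e # c) = records (e # ?f v)"
      using canonical_extension[OF _ _ can_z, of "?f v" n e] fb fz by (auto simp: e_def)
    have "set (z @ c) \<subseteq> {1..n}"
      using pres_cong_in_lists[OF c(3)] by auto
    moreover have "set c \<subseteq> set (?f v)" using c(2) by (metis subseq_set)
    ultimately have "set (z @ c) \<subseteq> {Suc k..n}" using zk by (auto simp: subset_iff)
    then have run_k: "star_run n w k = (k # z) @ c"
      using c(1,3) read join_from_star_run_cong[of "Suc k" b "z @ c" n] run fz by simp
    have "\<not> subseq (e # c) v"
    proof
      assume sub: "subseq (e # c) v"
      \<comment> \<open>Behind \<open>e\<close> only letters above \<open>e \<ge> k\<close> can be
        maxima, so the restriction to letters above \<open>k\<close> does not affect them.\<close>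
      have "filter (\<lambda>x. e < x) (?f v) = filter (\<lambda>x. e < x) v"
        using ke by (auto intro!: filter_cong)
      with c(4) have "records (e # c) = records ([e] @ v)" by simp
      then have "subseq (records ([e] @ v)) v"
        using sub subseq_records subseq_order.trans by metis
      \<comment> \<open>The word \<open>e # v\<close> is a suffix of \<open>w\<close> and so
        inherits separation from canonicity.\<close>
      moreover have "w = (a @ butlast (k # z)) @ (e # v)"
        by (cases z rule: rev_cases) (simp_all add: e_def ab zv)
      then have "separated ([e] @ v)"
        using w(1) canonical_appendD(2) by (intro canonical_separated) (metis append_Cons append_Nil)
      ultimately show False using separated_records by blast
    qed
    moreover have "subseq c v"
      using c(2) subseq_filter_left subseq_order.trans by blast
    ultimately show ?thesis
      unfolding d run_k by (subst word_join_eqI) (auto simp: e_def)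
  qed
qed

text \<open>The outer induction lowers \<open>m\<close>, the inner one counts joined components. The
  suffix is empty at first, as all letters are \<ge> \<open>m\<close>, and is \<open>w\<close> at
  the end, as no letter exceeds \<open>n\<close>.\<close>

lemma join_from_canonical:
  assumes "canonical w" "set w \<subseteq> {m..n}" "1 \<le> m"
  shows "join_from n m (star_run n w) = w"
  using assms
proof (induction "Suc n - m" arbitrary: m w rule: less_induct)
  case less
  have w: "w \<in> words n" using less.prems by (force simp: words_def)
  have "fold word_join (map (star_run n w) [m..<m + d]) [] = dropWhile (\<lambda>x. m + d \<le> x) w"
    if "m + d \<le> Suc n" for d
    using that
  proof (induction d)
    case 0
    have eq: "dropWhile (\<lambda>x. m \<le> x) w = []" using less.prems(2) by auto
    show ?case unfolding add_0_right eq by simp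
  next
    case (Suc d)
    moreover have "word_join (star_run n w (m + d)) (dropWhile (\<lambda>x. m + d \<le> x) w) =
        dropWhile (\<lambda>x. Suc (m + d) \<le> x) w"
    proof (rule dropWhile_join[OF less.prems(1) w])
      show "join_from n (Suc (m + d)) (star_run n c) = c"
        if "canonical c" "set c \<subseteq> {Suc (m + d)..n}" for c
        using that Suc.prems by (intro less.hyps) auto
    qed (use less.prems(3) Suc.prems in auto)
    ultimately show ?case by simp
  qed
  from this[of "Suc n - m"] show ?case
  proof (cases "m \<le> Suc n")
    case True
    have "dropWhile (\<lambda>x. Suc n \<le> x) w = w"
      using less.prems(2) by (cases w) auto
    with True \<open>m + (Suc n - m) \<le> Suc n \<Longrightarrow> _\<close> show ?thesis
      by (simp add: join_from_def del: upt_Suc)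
  next
    \<comment> \<open>For \<open>m > n + 1\<close> the inner claim says nothing, but then no letters
      are available and both sides are empty.\<close>
    case False
    with less.prems(2) show ?thesis by (simp add: join_from_def)
  qed
qed

section \<open>Canonical forms, equality of evolutions and the isomorphism\<close>

lemma kiselman_proj_eq_iff:
  assumes "u \<in> words n" "v \<in> words n"
  shows "kiselman_proj n u = kiselman_proj n v \<longleftrightarrow> (u, v) \<in> kiselman_cong n"
  unfolding kiselman_proj_def
  using assms by (intro eq_equiv_class_iff[OF equiv_pres_cong]) (simp_all add: words_def)

lemma star_run_kiselman_cong:
  "(u, v) \<in> kiselman_cong n \<Longrightarrow> star_run n u = star_run n v"
  by (simp add: star_run_def foldr_step_kiselman_cong)

text \<open>Congruent words have equal runs, and a canonical word is read off from its run; so a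
  canonical word in the class of \<open>w\<close> is determined by the run of \<open>w\<close>. With
  existence, this justifies the description operator in \<open>Can\<close>.\<close>

lemma Can_eq_join_from:
  assumes w: "w \<in> words n"
  shows "Can n w = join_from n 1 (star_run n w)" "(w, Can n w) \<in> kiselman_cong n"
proof -
  have unique: "c = join_from n 1 (star_run n w)"
    if "canonical c" "(w, c) \<in> kiselman_cong n" for c
  proof -
    have "set c \<subseteq> {1..n}" using pres_cong_in_lists[OF that(2)] by auto
    then show ?thesis
      using join_from_canonical[OF that(1), of 1 n] star_run_kiselman_cong[OF that(2)] by simp
  qed
  obtain c where c: "canonical c" "(w, c) \<in> kiselman_cong n"
    using canonical_representative[OF w] by blast
  have "Can n w = c"
    unfolding Can_def
  proof (rule the_equality)
    show "c \<in> words n \<and> kiselman_proj n c = kiselman_proj n w \<and> canonical c"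
      using c w pres_cong_in_lists[OF c(2)] kiselman_proj_eq_iff[of w n c]
      by (auto simp: words_def)
    show "d = c" if "d \<in> words n \<and> kiselman_proj n d = kiselman_proj n w \<and> canonical d" for d
      using that unique[OF c] unique[of d] kiselman_proj_eq_iff[OF w, of d] by metis
  qed
  with c unique show "Can n w = join_from n 1 (star_run n w)" "(w, Can n w) \<in> kiselman_cong n"
    by auto
qed

text \<open>Equal evolutions agree at the star state, hence give the same canonical form, to which
  both words are congruent.\<close>

lemma evolution_eq_iff_kiselman_cong:
  assumes "u \<in> words n" "v \<in> words n"
  shows "evolution n u = evolution n v \<longleftrightarrow> (u, v) \<in> kiselman_cong n"
proof
  assume "evolution n u = evolution n v"
  then have "join_from n 1 (star_run n u) = join_from n 1 (star_run n v)"
    using evolution_star_state[OF assms(1)] evolution_star_state[OF assms(2)]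
    by (intro join_from_cong) (metis atLeastAtMost_iff)
  then show "(u, v) \<in> kiselman_cong n"
    using Can_eq_join_from[OF assms(1)] Can_eq_join_from[OF assms(2)]
    by (metis pres_cong.sym pres_cong.trans)
qed (rule evolution_kiselman_cong)

lemma kiselman_iso_dynamics_monoid: "kiselman n \<cong> dynamics_monoid n"
proof -
  \<comment> \<open>The choice of representative is immaterial, since congruent words have the same
    evolution.\<close>
  define h where "h X = evolution n (SOME x. x \<in> X)" for X
  have carrier: "carrier (kiselman n) = kiselman_proj n ` words n"
    by (auto simp: kiselman_def presented_monoid_def kiselman_proj_def words_def quotient_def)
  have mult: "kiselman_proj n u \<otimes>\<^bsub>kiselman n\<^esub> kiselman_proj n v = kiselman_proj n (u @ v)"
    if "u \<in> words n" "v \<in> words n" for u v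
    using that presented_monoid_mult_class[of u "{1..n}" v "kiselman_rels n"]
    by (simp add: kiselman_def kiselman_proj_def words_def)
  have app: "u @ v \<in> words n" if "u \<in> words n" "v \<in> words n" for u v
    using that by (auto simp: words_def)
  have h: "h (kiselman_proj n u) = evolution n u" if "u \<in> words n" for u
  proof -
    have "u \<in> kiselman_proj n u"
      using that by (simp add: kiselman_proj_def words_def pres_cong.refl)
    then have "(SOME x. x \<in> kiselman_proj n u) \<in> kiselman_proj n u" by (rule someI)
    then show ?thesis
      unfolding h_def kiselman_proj_def by (intro evolution_kiselman_cong[symmetric]) simp
  qed
  have "h \<in> iso (kiselman n) (dynamics_monoid n)"
  proof (rule isoI)
    show "h \<in> hom (kiselman n) (dynamics_monoid n)"
      unfolding hom_def
      by (auto simp: carrier mult h app dynamics_monoid_def evolution_append)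
    show "bij_betw h (carrier (kiselman n)) (carrier (dynamics_monoid n))"
      unfolding bij_betw_def inj_on_def carrier
      by (auto simp: h dynamics_monoid_def image_image evolution_eq_iff_kiselman_cong
          kiselman_proj_eq_iff)
  qed
  then show ?thesis by (rule is_isoI)
qed

theorem theorem6p3:
  fixes n :: nat and w :: word and p :: "nat \<Rightarrow> word"
  assumes "n \<ge> 1" and "w \<in> words n" and "p = evolution n w (star_state n)"
  shows "Can n w = nested word_join (map p [1..<Suc n])
    \<and> (\<forall>u\<in>words n. \<forall>v\<in>words n. evolution n u = evolution n v \<longleftrightarrow> Can n u = Can n v)
    \<and> kiselman n \<cong> dynamics_monoid n"
proof (intro conjI ballI)
  have "join_from n 1 p = join_from n 1 (star_run n w)"
    using assms by (intro join_from_cong) (simp add: evolution_star_state)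
  moreover have "nested word_join (map p [1..<Suc n]) = join_from n 1 p"
    unfolding join_from_def using assms(1) by (intro nested_word_join) simp
  ultimately show "Can n w = nested word_join (map p [1..<Suc n])"
    using Can_eq_join_from(1)[OF assms(2)] by simp
next
  fix u v assume uv: "u \<in> words n" "v \<in> words n"
  show "evolution n u = evolution n v \<longleftrightarrow> Can n u = Can n v"
    unfolding evolution_eq_iff_kiselman_cong[OF uv]
    using Can_eq_join_from[OF uv(1)] Can_eq_join_from[OF uv(2)] star_run_kiselman_cong[of u v n]
    by (metis pres_cong.sym pres_cong.trans)
qed (rule kiselman_iso_dynamics_monoid)

end
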